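(* Let $n\ge 2$ be an integer and let $\mathcal{T}: L^1(\mathbb{Z}/n\mathbb{Z})\to L^1(\mathbb{Z}/n\mathbb{Z})$ be a bijective map (not necessarily linear) such that the map $\mathbb{C}\to L^1(\mathbb{Z}/n\mathbb{Z})$, $c\mapsto \mathcal{T}(c\mathbf{1})$, is continuous. Assume that (i) for every $a,b\in L^1(\mathbb{Z}/n\mathbb{Z})$, $\mathcal{T}(a\cdot b)=\mathcal{T}(a)\cdot\mathcal{T}(b)$; (ii) for every $a,b\in L^1(\mathbb{Z}/n\mathbb{Z})$, $\mathcal{T}(a*b)=\mathcal{T}(a)*\mathcal{T}(b)$. Then there exists $\eta\in\{1,\ldots,n-1\}$ that has no common divisor with $n$ (i.e. $\gcd(\eta,n)=1$) such that -- either, for every $j\in\mathbb{Z}/n\mathbb{Z}$ and every $a\in L^1(\mathbb{Z}/n\mathbb{Z})$, $\mathcal{T}(a)(\eta j)=a(j)$; -- or, for every $j\in\mathbb{Z}/n\mathbb{Z}$ and every $a\in L^1(\mathbb{Z}/n\mathbb{Z})$, $\mathcal{T}(a)(\eta j)=\overline{a(j)}$.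
   Context: $L^1(\mathbb{Z}/n\mathbb{Z})$ is the space of all functions $\mathbb{Z}/n\mathbb{Z}\to\mathbb{C}$, with its usual finite-dimensional topology. $\mathbf{1}=(1,\ldots,1)$ is the constant function equal to $1$. The product $a\cdot b$ is the pointwise product, and $a*b$ is the convolution $a*b(j)=\sum_{k\in\mathbb{Z}/n\mathbb{Z}}a(k)b(j-k)$. The bar denotes complex conjugation. *)

theory Defs
  imports "HOL-Analysis.Analysis" "HOL-Number_Theory.Residues"
begin

text \<open>
  The ring \<open>\<int>/n\<int>\<close> is the library's \<^term>\<open>residue_ring n\<close>, with carrier \<open>{0..n - 1}\<close>.
  A function on \<open>\<int>/n\<int>\<close> is represented by an extensional function on this carrier
  (it takes the value \<^term>\<open>undefined\<close> off the carrier), so that two elements of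
  \<open>L1 n\<close> are equal iff they agree on the carrier.
\<close>

definition L1 :: "int \<Rightarrow> (int \<Rightarrow> complex) set" where
  "L1 n = carrier (residue_ring n) \<rightarrow>\<^sub>E UNIV"

text \<open>The carrier is finite, so the product topology is the usual topology of \<open>\<complex>\<^sup>n\<close>.\<close>

definition L1_topology :: "int \<Rightarrow> (int \<Rightarrow> complex) topology" where
  "L1_topology n = product_topology (\<lambda>_. euclidean) (carrier (residue_ring n))"

definition L1_one :: "int \<Rightarrow> int \<Rightarrow> complex" where
  "L1_one n = (\<lambda>j\<in>carrier (residue_ring n). 1)"

definition L1_scale :: "int \<Rightarrow> complex \<Rightarrow> (int \<Rightarrow> complex) \<Rightarrow> int \<Rightarrow> complex" where
  "L1_scale n c a = (\<lambda>j\<in>carrier (residue_ring n). c * a j)"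

definition L1_mult :: "int \<Rightarrow> (int \<Rightarrow> complex) \<Rightarrow> (int \<Rightarrow> complex) \<Rightarrow> int \<Rightarrow> complex" where
  "L1_mult n a b = (\<lambda>j\<in>carrier (residue_ring n). a j * b j)"

definition L1_conv :: "int \<Rightarrow> (int \<Rightarrow> complex) \<Rightarrow> (int \<Rightarrow> complex) \<Rightarrow> int \<Rightarrow> complex" where
  "L1_conv n a b = (\<lambda>j\<in>carrier (residue_ring n).
     \<Sum>k\<in>carrier (residue_ring n). a k * b (j \<ominus>\<^bsub>residue_ring n\<^esub> k))"

end

theory Submission imports Defs begin

text \<open>
  The two products, seen separately, each leave a great deal of freedom; together they leave almost
  none, because the point masses \<open>\<delta>\<^sub>j\<close> are distinguished for both. For the pointwise product they
  are the minimal nonzero idempotents, so a multiplicative bijection \<open>T\<close> permutes them, say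
  \<open>T \<delta>\<^sub>j = \<delta>\<^bsub>\<sigma> j\<^esub>\<close> (\<open>image_point_mass\<close>). For the convolution they form a copy of the group
  \<open>\<int>/n\<int>\<close>, since \<open>\<delta>\<^sub>i * \<delta>\<^sub>k = \<delta>\<^bsub>i + k\<^esub>\<close>, so \<open>\<sigma>\<close> is an automorphism of this group, that is,
  multiplication by a unit \<open>\<eta> = \<sigma> 1\<close> (\<open>site_linear\<close>, \<open>site_coprime\<close>).

  It remains to find the values. Convolution with a point mass is a translation, and the constant
  functions are the translation invariant ones, so \<open>T\<close> maps constants to constants:
  \<open>T (c \<one>) = f c \<one>\<close> for some \<open>f : \<complex> \<rightarrow> \<complex>\<close>. Since \<open>a \<cdot> \<delta>\<^sub>j = (a j \<one>) \<cdot> \<delta>\<^sub>j\<close>, applying \<open>T\<close>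
  shows that the same \<open>f\<close> governs all values: \<open>T a (\<sigma> j) = f (a j)\<close> (\<open>T_at_site\<close>).
  The map \<open>f\<close> is multiplicative because \<open>T\<close> is. It is additive because convolution with \<open>\<one>\<close>
  turns a function into the constant equal to the sum of its values, and as \<open>n \<ge> 2\<close> any two numbers
  are the values of some function at two different points (\<open>value_map_add\<close>).
  So \<open>f\<close> is a continuous ring endomorphism of \<open>\<complex>\<close>, and these are only the identity and
  the conjugation (\<open>continuous_ring_endomorphism_complex\<close>).
\<close>

section \<open>Continuous ring endomorphisms of the complex numbers\<close>

text \<open>
  Ring axioms force \<open>f\<close> to fix the rationals, continuity extends this to the reals, and
  \<open>f \<i>\<close> must be a square root of \<open>-1\<close>.
\<close>

lemma continuous_ring_endomorphism_complex:
  fixes f :: "complex \<Rightarrow> complex"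
  assumes cont: "continuous_on UNIV f"
    and add: "\<And>x y. f (x + y) = f x + f y"
    and mult: "\<And>x y. f (x * y) = f x * f y"
    and one: "f 1 = 1"
  shows "f = id \<or> f = cnj"
proof -
  have zero: "f 0 = 0" using add[of 0 0] by simp
  have minus: "f (- x) = - f x" for x
    using add[of x "- x"] zero by (simp add: eq_neg_iff_add_eq_0 add.commute)
  have nat: "f (of_nat m) = of_nat m" for m
    by (induction m) (simp_all add: zero add one)
  have int: "f (of_int i) = of_int i" for i
    by (cases i rule: int_cases2) (simp_all add: nat minus)
  have rat: "f (of_real r) = of_real r" if r: "r \<in> \<rat>" for r
  proof -
    obtain i m where m: "m \<noteq> 0" "r = real_of_int i / real m"
      using r by (auto simp: Rats_eq_int_div_nat)
    have "complex_of_real r * of_nat m = of_int i" using m by simp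
    then have "f (complex_of_real r) * of_nat m = complex_of_real r * of_nat m"
      using mult[of "complex_of_real r" "of_nat m"] by (simp only: nat int)
    then show ?thesis using m(1) by (simp only: mult_cancel_right of_nat_eq_0_iff simp_thms)
  qed
  have real: "f (of_real r) = of_real r" for r
  proof -
    have "continuous_on (closure \<rat>) (\<lambda>r. f (of_real r) - of_real r)"
      by (intro continuous_intros continuous_on_compose2[OF cont]) auto
    then have "f (of_real r) - of_real r = 0"
      by (rule continuous_constant_on_closure) (simp_all add: rat Rats_closure_real)
    then show ?thesis by simp
  qed
  have decomp: "f z = of_real (Re z) + f \<i> * of_real (Im z)" for z
    using arg_cong[OF complex_eq[of z], of f] by (simp add: add mult real)
  have "f \<i> * f \<i> = - 1" using mult[of \<i> \<i>] minus[of 1] one by simp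
  then have "f \<i> = \<i> \<or> f \<i> = - \<i>" by (metis i_squared square_eq_iff)
  then show ?thesis
  proof
    assume "f \<i> = \<i>"
    then have "f z = id z" for z using decomp[of z] complex_eq[of z] by simp
    then show ?thesis by blast
  next
    assume "f \<i> = - \<i>"
    then have "f z = cnj z" for z using decomp[of z] by (simp add: complex_eq_iff)
    then show ?thesis by blast
  qed
qed

section \<open>Point masses and constants\<close>

definition point_mass :: "int \<Rightarrow> int \<Rightarrow> int \<Rightarrow> complex" where
  "point_mass n i = (\<lambda>j\<in>{0..n - 1}. if j = i then 1 else 0)"

definition const_fun :: "int \<Rightarrow> complex \<Rightarrow> int \<Rightarrow> complex" where
  "const_fun n c = (\<lambda>j\<in>{0..n - 1}. c)"

lemma carrier_residue_ring: "carrier (residue_ring n) = {0..n - 1}"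
  by (simp add: residue_ring_def)

lemma L1_scale_one: "L1_scale n c (L1_one n) = const_fun n c"
  by (auto simp: L1_scale_def L1_one_def const_fun_def carrier_residue_ring)

lemma L1_mult_eq: "L1_mult n a b = (\<lambda>j\<in>{0..n - 1}. a j * b j)"
  by (simp add: L1_mult_def carrier_residue_ring)

lemma const_fun_at: "j \<in> {0..n - 1} \<Longrightarrow> const_fun n c j = c"
  by (simp add: const_fun_def)

lemma L1_mult_at: "j \<in> {0..n - 1} \<Longrightarrow> L1_mult n a b j = a j * b j"
  by (simp add: L1_mult_eq)

lemma L1_conv_eq:
  assumes "n \<ge> 2"
  shows "L1_conv n a b = (\<lambda>j\<in>{0..n - 1}. \<Sum>k\<in>{0..n - 1}. a k * b ((j - k) mod n))"
proof -
  interpret residues n "residue_ring n" by unfold_locales (use assms in auto)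
  show ?thesis
    by (simp add: L1_conv_def carrier_residue_ring a_minus_def res_neg_eq res_add_eq
        mod_add_right_eq)
qed

lemma L1_conv_at:
  assumes "n \<ge> 2" "j \<in> {0..n - 1}"
  shows "L1_conv n a b j = (\<Sum>k\<in>{0..n - 1}. a k * b ((j - k) mod n))"
  unfolding L1_conv_eq[OF assms(1)] by (rule restrict_apply'[OF assms(2)])

lemma in_L1_iff: "a \<in> L1 n \<longleftrightarrow> a \<in> extensional {0..n - 1}"
  by (simp add: L1_def carrier_residue_ring PiE_def)

lemma L1_eqI:
  assumes "a \<in> L1 n" "b \<in> L1 n" "\<And>j. j \<in> {0..n - 1} \<Longrightarrow> a j = b j"
  shows "a = b"
  using assms by (auto simp: in_L1_iff intro: extensionalityI)

lemma point_mass_in_L1 [simp]: "point_mass n i \<in> L1 n"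
  by (simp add: in_L1_iff point_mass_def)

lemma const_fun_in_L1 [simp]: "const_fun n c \<in> L1 n"
  by (simp add: in_L1_iff const_fun_def)

lemma L1_mult_in_L1 [simp]: "L1_mult n a b \<in> L1 n"
  by (simp add: in_L1_iff L1_mult_eq)

lemma L1_mult_zero:
  "L1_mult n a (const_fun n 0) = const_fun n 0"
  "L1_mult n (const_fun n 0) a = const_fun n 0"
  by (auto simp: L1_mult_eq const_fun_def)

lemma L1_mult_one:
  assumes "a \<in> L1 n"
  shows "L1_mult n a (const_fun n 1) = a" "L1_mult n (const_fun n 1) a = a"
  by (rule L1_eqI[of _ n]; simp add: assms L1_mult_at const_fun_at)+

lemma L1_conv_in_L1 [simp]: "L1_conv n a b \<in> L1 n"
  by (simp add: in_L1_iff L1_conv_def carrier_residue_ring)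

lemma point_mass_inject:
  assumes "i \<in> {0..n - 1}" "point_mass n i = point_mass n k"
  shows "i = k"
  using fun_cong[OF assms(2), of i] assms(1) by (auto simp: point_mass_def split: if_splits)

lemma conv_point_mass_at:
  assumes "n \<ge> 2" "i \<in> {0..n - 1}" "j \<in> {0..n - 1}"
  shows "L1_conv n (point_mass n i) b j = b ((j - i) mod n)"
proof -
  have "L1_conv n (point_mass n i) b j
      = (\<Sum>k\<in>{0..n - 1}. if k = i then b ((j - k) mod n) else 0)"
    unfolding L1_conv_at[OF assms(1,3)] by (rule sum.cong) (auto simp: point_mass_def)
  then show ?thesis using assms(2) by simp
qed

lemma conv_point_masses:
  assumes "n \<ge> 2" "i \<in> {0..n - 1}" "k \<in> {0..n - 1}"
  shows "L1_conv n (point_mass n i) (point_mass n k) = point_mass n ((i + k) mod n)"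
proof (rule L1_eqI)
  fix j assume j: "j \<in> {0..n - 1}"
  have "(j - i) mod n = k \<longleftrightarrow> j = (i + k) mod n"
  proof
    assume "(j - i) mod n = k"
    then have "(i + k) mod n = (i + (j - i)) mod n" by (metis mod_add_right_eq)
    then show "j = (i + k) mod n" using j by simp
  next
    assume "j = (i + k) mod n"
    then have "(j - i) mod n = ((i + k) - i) mod n" by (simp add: mod_diff_left_eq)
    then show "(j - i) mod n = k" using assms(3) by simp
  qed
  moreover have "(j - i) mod n \<in> {0..n - 1}" using assms(1) by simp
  ultimately show "L1_conv n (point_mass n i) (point_mass n k) j = point_mass n ((i + k) mod n) j"
    unfolding conv_point_mass_at[OF assms(1,2) j] using j by (simp add: point_mass_def)
qed simp_all

lemma conv_const_fun:
  assumes "n \<ge> 2"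
  shows "L1_conv n a (const_fun n 1) = const_fun n (\<Sum>k\<in>{0..n - 1}. a k)"
proof (rule L1_eqI)
  fix j assume j: "j \<in> {0..n - 1}"
  have "const_fun n 1 ((j - k) mod n) = 1" for k
    using assms by (simp add: const_fun_def)
  then show "L1_conv n a (const_fun n 1) j = const_fun n (\<Sum>k\<in>{0..n - 1}. a k) j"
    unfolding L1_conv_at[OF assms j] using j by (simp add: const_fun_def)
qed simp_all

section \<open>Bijections that preserve both products\<close>

locale L1_double_automorphism =
  fixes n :: int and T :: "(int \<Rightarrow> complex) \<Rightarrow> (int \<Rightarrow> complex)"
  assumes n: "n \<ge> 2"
    and bij: "bij_betw T (L1 n) (L1 n)"
    and T_mult: "\<And>a b. a \<in> L1 n \<Longrightarrow> b \<in> L1 n \<Longrightarrow> T (L1_mult n a b) = L1_mult n (T a) (T b)"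
    and T_conv: "\<And>a b. a \<in> L1 n \<Longrightarrow> b \<in> L1 n \<Longrightarrow> T (L1_conv n a b) = L1_conv n (T a) (T b)"
begin

lemma T_in_L1 [simp]: "a \<in> L1 n \<Longrightarrow> T a \<in> L1 n"
  using bij by (rule bij_betw_apply)

lemma T_surj:
  assumes "b \<in> L1 n"
  obtains a where "a \<in> L1 n" "T a = b"
  using assms bij unfolding bij_betw_def by (metis imageE)

lemma T_eq_iff: "a \<in> L1 n \<Longrightarrow> b \<in> L1 n \<Longrightarrow> T a = T b \<longleftrightarrow> a = b"
  using bij by (meson bij_betw_imp_inj_on inj_on_eq_iff)

text \<open>The constants 0 and 1 are the absorbing and the neutral element of the pointwise product.\<close>

lemma T_zero: "T (const_fun n 0) = const_fun n 0"
proof -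
  obtain b where b: "b \<in> L1 n" "T b = const_fun n 0" using T_surj const_fun_in_L1 by metis
  then show ?thesis
    using T_mult[of "const_fun n 0" b] by (simp add: L1_mult_zero)
qed

lemma T_one: "T (const_fun n 1) = const_fun n 1"
proof -
  obtain b where b: "b \<in> L1 n" "T b = const_fun n 1" using T_surj const_fun_in_L1 by metis
  then have "const_fun n 1 = L1_mult n (T (const_fun n 1)) (const_fun n 1)"
    using T_mult[of "const_fun n 1" b] by (simp add: L1_mult_one)
  then show ?thesis by (simp add: L1_mult_one)
qed

text \<open>
  Minimality is used in the following form. The function \<open>T \<delta>\<^sub>j\<close> is nonzero at some \<open>k\<close>, where its
  value is 1 by idempotence. Hence \<open>\<delta>\<^sub>k = T \<delta>\<^sub>j \<cdot> \<delta>\<^sub>k\<close>, which makes the preimage of \<open>\<delta>\<^sub>k\<close>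
  an idempotent multiple of \<open>\<delta>\<^sub>j\<close>, different from 0, so equal to \<open>\<delta>\<^sub>j\<close>.
\<close>

lemma image_point_mass:
  assumes j: "j \<in> {0..n - 1}"
  shows "\<exists>k\<in>{0..n - 1}. T (point_mass n j) = point_mass n k"
proof -
  let ?d = "point_mass n j"
  have idem: "L1_mult n (point_mass n i) (point_mass n i) = point_mass n i" for i
    by (auto simp: L1_mult_eq point_mass_def)
  have "?d \<noteq> const_fun n 0"
    using j by (auto simp: point_mass_def const_fun_def fun_eq_iff)
  then have "T ?d \<noteq> const_fun n 0"
    using T_eq_iff[of ?d "const_fun n 0"] T_zero by simp
  then obtain k where k: "k \<in> {0..n - 1}" "T ?d k \<noteq> 0"
    using L1_eqI[of "T ?d" n "const_fun n 0"] const_fun_at[of _ n 0]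
    by (metis T_in_L1 const_fun_in_L1 point_mass_in_L1)
  have "L1_mult n (T ?d) (T ?d) = T ?d"
    using T_mult[of ?d ?d] idem by simp
  then have "T ?d k * T ?d k = T ?d k"
    using L1_mult_at[OF k(1), of "T ?d" "T ?d"] by simp
  then have T_k: "T ?d k = 1" using k(2) by simp
  obtain b where b: "b \<in> L1 n" "T b = point_mass n k" using T_surj point_mass_in_L1 by metis
  have "L1_mult n (T ?d) (point_mass n k) = point_mass n k"
    using T_k by (auto simp: L1_mult_eq point_mass_def)
  then have "T (L1_mult n ?d b) = T b"
    using T_mult[of ?d b] b by simp
  then have d_b: "L1_mult n ?d b = b"
    using T_eq_iff b(1) by (metis L1_mult_in_L1)
  have "T (L1_mult n b b) = T b"
    using T_mult[of b b] b idem by simp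
  then have "L1_mult n b b = b"
    using T_eq_iff b(1) by (metis L1_mult_in_L1)
  then have "b j * b j = b j"
    using L1_mult_at[OF j, of b b] by simp
  then have "b j = 0 \<or> b j = 1" by simp
  moreover have off: "b i = 0" if "i \<in> {0..n - 1}" "i \<noteq> j" for i
    using fun_cong[OF d_b, of i] that by (simp add: L1_mult_eq point_mass_def)
  moreover have "b j \<noteq> 0"
  proof
    assume "b j = 0"
    then have "b = const_fun n 0"
      using b off by (intro L1_eqI[of b n]) (auto simp: const_fun_at)
    then have "point_mass n k k = const_fun n 0 k" using b T_zero by simp
    then show False using k by (simp add: point_mass_def const_fun_def)
  qed
  ultimately have "b = ?d"
    using b by (intro L1_eqI[of b n] point_mass_in_L1) (auto simp: point_mass_def)
  then show ?thesis using b k by auto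
qed

text \<open>The permutation \<open>\<sigma>\<close> with \<open>T \<delta>\<^sub>j = \<delta>\<^bsub>\<sigma> j\<^esub>\<close>, meaningful on \<open>{0..n - 1}\<close> only.\<close>

definition site :: "int \<Rightarrow> int" where
  "site j = (SOME k. k \<in> {0..n - 1} \<and> T (point_mass n j) = point_mass n k)"

lemma
  assumes "j \<in> {0..n - 1}"
  shows site_in: "site j \<in> {0..n - 1}"
    and T_point_mass: "T (point_mass n j) = point_mass n (site j)"
  using someI_ex[of "\<lambda>k. k \<in> {0..n - 1} \<and> T (point_mass n j) = point_mass n k"]
    image_point_mass[OF assms] unfolding site_def by blast+

lemma site_bij: "bij_betw site {0..n - 1} {0..n - 1}"
proof -
  have "inj_on site {0..n - 1}"
  proof (rule inj_onI)
    fix i j assume ij: "i \<in> {0..n - 1}" "j \<in> {0..n - 1}" "site i = site j"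
    then have "T (point_mass n i) = T (point_mass n j)" by (simp add: T_point_mass)
    then have "point_mass n i = point_mass n j" by (simp add: T_eq_iff)
    then show "i = j" using ij(1) by (rule point_mass_inject[rotated])
  qed
  moreover from this have "site ` {0..n - 1} = {0..n - 1}"
    by (intro endo_inj_surj) (use site_in in auto)
  ultimately show ?thesis by (simp add: bij_betw_def)
qed

lemma site_add:
  assumes "i \<in> {0..n - 1}" "k \<in> {0..n - 1}"
  shows "site ((i + k) mod n) = (site i + site k) mod n"
proof -
  have ik: "(i + k) mod n \<in> {0..n - 1}" using n by simp
  have "point_mass n (site ((i + k) mod n)) = T (L1_conv n (point_mass n i) (point_mass n k))"
    using conv_point_masses[OF n assms] T_point_mass[OF ik] by simp
  also have "\<dots> = L1_conv n (point_mass n (site i)) (point_mass n (site k))"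
    using T_conv assms by (simp add: T_point_mass)
  also have "\<dots> = point_mass n ((site i + site k) mod n)"
    using conv_point_masses[OF n] site_in assms by simp
  finally show ?thesis using point_mass_inject[OF site_in[OF ik]] by simp
qed

text \<open>An additive map of the cyclic group \<open>\<int>/n\<int>\<close> is determined by the image of the generator 1.\<close>

lemma site_linear:
  assumes "j \<in> {0..n - 1}"
  shows "site j = (site 1 * j) mod n"
proof -
  have site_0: "site 0 \<in> {0..n - 1}" using site_in n by simp
  have "site 0 = (site 0 + site 0) mod n" using site_add[of 0 0] n by simp
  then have "(site 0 + site 0) mod n = site 0 mod n" using site_0 by simp
  then have "n dvd site 0" by (simp add: mod_eq_dvd_iff)
  then have zero: "site 0 = 0" using zdvd_not_zless[of "site 0" n] site_0 by (cases "site 0 = 0") auto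
  have "int m < n \<longrightarrow> site (int m) = (site 1 * int m) mod n" for m
  proof (induction m)
    case 0
    then show ?case using zero by simp
  next
    case (Suc m)
    show ?case
    proof
      assume m: "int (Suc m) < n"
      then have "site (int (Suc m)) = (site (int m) + site 1) mod n"
        using site_add[of "int m" 1] by (simp add: add.commute)
      also have "\<dots> = (site 1 * int m + site 1) mod n"
        using Suc m by (simp add: mod_add_left_eq)
      finally show "site (int (Suc m)) = (site 1 * int (Suc m)) mod n"
        by (simp add: algebra_simps)
    qed
  qed
  from this[of "nat j"] show ?thesis using assms by simp
qed

lemma site_coprime: "coprime (site 1) n"
proof -
  have "1 \<in> site ` {0..n - 1}" using site_bij n by (simp add: bij_betw_def)
  then obtain j where j: "j \<in> {0..n - 1}" "site j = 1" by auto
  then have "[site 1 * j = 1] (mod n)" using site_linear[OF j(1)] n by (simp add: cong_def)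
  then show ?thesis using coprime_iff_invertible_int by blast
qed

text \<open>
  The function \<open>f\<close> with \<open>T (c \<one>) = f c \<one>\<close>. As \<open>T (c \<one>)\<close> turns out to be constant,
  any point could replace 0.
\<close>

definition value_map :: "complex \<Rightarrow> complex" where
  "value_map c = T (const_fun n c) 0"

text \<open>A constant is invariant under all translations, that is, convolutions with point masses.\<close>

lemma T_const_fun_at_site:
  assumes j: "j \<in> {0..n - 1}"
  shows "T (const_fun n c) (site j) = value_map c"
proof -
  have "L1_conv n (point_mass n j) (const_fun n c) = const_fun n c"
  proof (rule L1_eqI)
    fix i assume i: "i \<in> {0..n - 1}"
    show "L1_conv n (point_mass n j) (const_fun n c) i = const_fun n c i"
      unfolding conv_point_mass_at[OF n j i] using i n by (simp add: const_fun_def)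
  qed simp_all
  then have "L1_conv n (point_mass n (site j)) (T (const_fun n c)) = T (const_fun n c)"
    using T_conv[of "point_mass n j" "const_fun n c"] T_point_mass[OF j] by simp
  then have "T (const_fun n c) (site j)
      = L1_conv n (point_mass n (site j)) (T (const_fun n c)) (site j)" by simp
  also have "\<dots> = T (const_fun n c) 0"
    using conv_point_mass_at[OF n site_in[OF j] site_in[OF j]] by simp
  finally show ?thesis by (simp add: value_map_def)
qed

text \<open>
  Near \<open>j\<close>, that is, after multiplication by \<open>\<delta>\<^sub>j\<close>, the function \<open>a\<close> cannot be told from the
  constant \<open>a j\<close>, for which the value is known.
\<close>

lemma T_at_site:
  assumes j: "j \<in> {0..n - 1}" and a: "a \<in> L1 n"
  shows "T a (site j) = value_map (a j)"
proof -
  have at_site: "L1_mult n (T b) (point_mass n (site j)) (site j) = T b (site j)" for b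
    using site_in[OF j] by (simp add: L1_mult_eq point_mass_def)
  have "L1_mult n a (point_mass n j) = L1_mult n (const_fun n (a j)) (point_mass n j)"
    by (auto simp: L1_mult_eq point_mass_def const_fun_def)
  then have "L1_mult n (T a) (point_mass n (site j))
      = L1_mult n (T (const_fun n (a j))) (point_mass n (site j))"
    using T_mult[of a "point_mass n j"] T_mult[of "const_fun n (a j)" "point_mass n j"] a
      T_point_mass[OF j] by simp
  then have "T a (site j) = T (const_fun n (a j)) (site j)" by (metis at_site)
  then show ?thesis by (simp add: T_const_fun_at_site[OF j])
qed

lemma value_map_zero: "value_map 0 = 0"
  using n by (simp add: value_map_def T_zero) (simp add: const_fun_def)

lemma value_map_one: "value_map 1 = 1"
  using n by (simp add: value_map_def T_one) (simp add: const_fun_def)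

lemma value_map_mult: "value_map (c * d) = value_map c * value_map d"
proof -
  have "const_fun n (c * d) = L1_mult n (const_fun n c) (const_fun n d)"
    by (auto simp: const_fun_def L1_mult_eq)
  then show ?thesis
    using T_mult[of "const_fun n c" "const_fun n d"] n
    by (simp add: value_map_def) (simp add: L1_mult_eq)
qed

text \<open>Convolution with \<open>\<one>\<close> sums the values, and \<open>\<sigma>\<close> only permutes the summands.\<close>

lemma value_map_sum:
  assumes a: "a \<in> L1 n"
  shows "value_map (\<Sum>j\<in>{0..n - 1}. a j) = (\<Sum>j\<in>{0..n - 1}. value_map (a j))"
proof -
  have "T (const_fun n (\<Sum>j\<in>{0..n - 1}. a j)) = L1_conv n (T a) (const_fun n 1)"
    using T_conv[OF a const_fun_in_L1[of n 1]] T_one conv_const_fun[OF n, of a] by simp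
  also have "\<dots> = const_fun n (\<Sum>k\<in>{0..n - 1}. T a k)"
    by (rule conv_const_fun[OF n])
  also have "(\<Sum>k\<in>{0..n - 1}. T a k) = (\<Sum>j\<in>{0..n - 1}. T a (site j))"
    by (rule sum.reindex_bij_betw[OF site_bij, symmetric])
  also have "\<dots> = (\<Sum>j\<in>{0..n - 1}. value_map (a j))"
    by (rule sum.cong) (simp_all add: T_at_site a)
  finally show ?thesis
    using n by (simp add: value_map_def) (simp add: const_fun_def)
qed

text \<open>
  This is where \<open>n \<ge> 2\<close> matters: the points 0 and 1 are distinct, so the general sum rule contains
  the case of two arbitrary summands.
\<close>

lemma value_map_add: "value_map (x + y) = value_map x + value_map y"
proof -
  define a where "a = (\<lambda>j\<in>{0..n - 1}. if j = 0 then x else if j = 1 then y else 0)"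
  have sum_a: "(\<Sum>j\<in>{0..n - 1}. g (a j)) = g x + g y" if g: "g 0 = 0" for g :: "complex \<Rightarrow> complex"
  proof -
    have "(\<Sum>j\<in>{0..n - 1}. g (a j)) = (\<Sum>j\<in>{0, 1}. g (a j))"
      by (rule sum.mono_neutral_right) (use n g in \<open>auto simp: a_def\<close>)
    then show ?thesis using n by (simp add: a_def)
  qed
  have "a \<in> L1 n" by (simp add: in_L1_iff a_def)
  from value_map_sum[OF this] show ?thesis
    using sum_a[of "\<lambda>z. z"] sum_a[of value_map] value_map_zero by simp
qed

end

section \<open>The classification\<close>

theorem theorem2p2:
  fixes n :: int and T :: "(int \<Rightarrow> complex) \<Rightarrow> (int \<Rightarrow> complex)"
  assumes "n \<ge> 2"
    and "bij_betw T (L1 n) (L1 n)"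
    and "continuous_map euclidean (L1_topology n) (\<lambda>c. T (L1_scale n c (L1_one n)))"
    and "\<And>a b. a \<in> L1 n \<Longrightarrow> b \<in> L1 n \<Longrightarrow> T (L1_mult n a b) = L1_mult n (T a) (T b)"
    and "\<And>a b. a \<in> L1 n \<Longrightarrow> b \<in> L1 n \<Longrightarrow> T (L1_conv n a b) = L1_conv n (T a) (T b)"
  shows "\<exists>\<eta>\<in>{1..n - 1}. coprime \<eta> n \<and>
    ((\<forall>j\<in>carrier (residue_ring n). \<forall>a\<in>L1 n. T a (\<eta> \<otimes>\<^bsub>residue_ring n\<^esub> j) = a j) \<or>
     (\<forall>j\<in>carrier (residue_ring n). \<forall>a\<in>L1 n. T a (\<eta> \<otimes>\<^bsub>residue_ring n\<^esub> j) = cnj (a j)))"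
proof -
  interpret L1_double_automorphism n T
    using assms(1,2,4,5) by unfold_locales
  have "continuous_map euclidean euclidean value_map"
    using assms(3) n unfolding L1_topology_def continuous_map_componentwise L1_scale_one
      carrier_residue_ring value_map_def by simp
  then have "value_map = id \<or> value_map = cnj"
    by (intro continuous_ring_endomorphism_complex)
      (simp_all add: value_map_add value_map_mult value_map_one)
  moreover have "T a (site 1 \<otimes>\<^bsub>residue_ring n\<^esub> j) = value_map (a j)"
    if "j \<in> carrier (residue_ring n)" "a \<in> L1 n" for j a
    using T_at_site[of j a] site_linear[of j] that
    by (simp add: residue_ring_def)
  moreover have "site 1 \<in> {1..n - 1}"
  proof -
    \<comment> \<open>The value 0 is excluded because 0 is a unit modulo \<open>n\<close> only for \<open>n = 1\<close>.\<close>
    have "site 1 \<noteq> 0" using site_coprime n by auto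
    then show ?thesis using site_in[of 1] n by auto
  qed
  ultimately show ?thesis
    using site_coprime by (intro bexI[of _ "site 1"]) auto
qed

end
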